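(* Let $q=p(p-1)/2$. If $\mathrm{pen}_D=0$ and $\liminf_{|x|\to\infty}\big(q\,\mathrm{pen}(x)-\log|x|\big)=-\infty$, then for every $p\times p$ matrix $S$ that is positive semidefinite but not positive definite, the penalised likelihood estimate $\hat\Theta_{\mathrm{Pen}}$ does not exist.
   Context: Fix an integer $p\ge 1$. All matrices are real symmetric $p\times p$; $\Theta=(\theta_{ij})\succ 0$ means $\Theta$ is positive definite. The off-diagonal penalty $\mathrm{pen}:\mathbb{R}\to\mathbb{R}$ is non-negative, symmetric around $0$, non-decreasing in $|x|$ and continuous, and $\mathrm{pen}_D:(0,\infty)\to\mathbb{R}$ denotes the diagonal penalty. Define $$\mathrm{Pen}(\Theta)=\sum_{i=1}^p \mathrm{pen}_D(\theta_{ii})+\sum_{i<j}\mathrm{pen}(\theta_{ij}),\qquad l_{\mathrm{Pen}}(\Theta\mid S)=\log\det\Theta-\mathrm{tr}(S\Theta)-\mathrm{Pen}(\Theta),\quad \Theta\succ 0.$$ The penalised likelihood estimate is $\hat\Theta_{\mathrm{Pen}}=\mathrm{argmax}_{\Theta\succ 0}\, l_{\mathrm{Pen}}(\Theta\mid S)$; it is said to exist if the supremum of $l_{\mathrm{Pen}}(\cdot\mid S)$ over positive definite $\Theta$ is finite and attained. *)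

theory Defs
  imports "HOL-Analysis.Analysis"
begin

(* The index type 'p plays the role of {1..p}; its linear order is only used to
   express the sum over pairs i < j. *)

definition sym_matrix :: "real^'p^'p \<Rightarrow> bool" where
  "sym_matrix A \<longleftrightarrow> transpose A = A"

definition pos_def :: "real^'p^'p \<Rightarrow> bool" where
  "pos_def A \<longleftrightarrow> sym_matrix A \<and> (\<forall>v. v \<noteq> 0 \<longrightarrow> v \<bullet> (A *v v) > 0)"

definition pos_semidef :: "real^'p^'p \<Rightarrow> bool" where
  "pos_semidef A \<longleftrightarrow> sym_matrix A \<and> (\<forall>v. v \<bullet> (A *v v) \<ge> 0)"

definition offdiag_penalty :: "(real \<Rightarrow> real) \<Rightarrow> bool" where
  "offdiag_penalty pen \<longleftrightarrow>
     (\<forall>x. 0 \<le> pen x) \<and>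
     (\<forall>x. pen (- x) = pen x) \<and>
     (\<forall>x y. \<bar>x\<bar> \<le> \<bar>y\<bar> \<longrightarrow> pen x \<le> pen y) \<and>
     continuous_on UNIV pen"

definition Pen ::
  "(real \<Rightarrow> real) \<Rightarrow> (real \<Rightarrow> real) \<Rightarrow> real^('p::{finite,linorder})^('p::{finite,linorder}) \<Rightarrow> real" where
  "Pen penD pen \<Theta> =
     (\<Sum>i\<in>UNIV. penD (\<Theta> $ i $ i)) + (\<Sum>(i, j)\<in>{(i, j). i < j}. pen (\<Theta> $ i $ j))"

definition pen_loglik ::
  "(real \<Rightarrow> real) \<Rightarrow> (real \<Rightarrow> real) \<Rightarrow> real^('p::{finite,linorder})^('p::{finite,linorder}) \<Rightarrow>
   real^('p::{finite,linorder})^('p::{finite,linorder}) \<Rightarrow> real" where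
  "pen_loglik penD pen S \<Theta> = ln (det \<Theta>) - trace (S ** \<Theta>) - Pen penD pen \<Theta>"

(* SUP over the reals is only meaningful together with the boundedness conjunct. *)
definition pen_estimate_exists ::
  "(real \<Rightarrow> real) \<Rightarrow> (real \<Rightarrow> real) \<Rightarrow> real^('p::{finite,linorder})^('p::{finite,linorder}) \<Rightarrow> bool" where
  "pen_estimate_exists penD pen S \<longleftrightarrow>
     bdd_above (pen_loglik penD pen S ` {\<Theta>. pos_def \<Theta>}) \<and>
     (\<exists>\<Theta>. pos_def \<Theta> \<and>
        pen_loglik penD pen S \<Theta> = (SUP \<Theta>'\<in>{\<Theta>. pos_def \<Theta>}. pen_loglik penD pen S \<Theta>'))"

end

theory Submission
  imports Defs
begin

(* If v is a unit vector with v \<bullet> S v = 0, the positive definite matrices I + t v v^T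
   have determinant 1 + t and constant value of tr(S \<Theta>), while their off-diagonal entries are
   bounded by t in absolute value. Hence the penalised log-likelihood at I + t v v^T is at least
   ln t - q pen t - tr S, and the liminf hypothesis makes this unbounded above. *)

definition rank_one_update :: "real^'n^'n::finite \<Rightarrow> real \<Rightarrow> real^'n \<Rightarrow> real^'n^'n" where
  "rank_one_update A t v = (\<chi> i j. A $ i $ j + t * v $ i * v $ j)"

lemma rank_one_update_nth [simp]:
  "rank_one_update A t v $ i $ j = A $ i $ j + t * v $ i * v $ j"
  by (simp add: rank_one_update_def)

text \<open>Since \<open>A\<close> v v^T \<open>A\<close>^T is the outer product of
  \<open>A *v v\<close> with itself, an orthogonal change of basis can move the direction of the
  update to a coordinate axis.\<close>

lemma matrix_mult_rank_one_update:
  "A ** rank_one_update B t v ** transpose A = rank_one_update (A ** B ** transpose A) t (A *v v)"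
  apply (simp add: vec_eq_iff matrix_matrix_mult_def matrix_vector_mult_def transpose_def
      sum_distrib_left sum_distrib_right sum.distrib algebra_simps)
  apply (intro allI)
  apply (subst sum.swap)
  apply (simp add: mult_ac)
  done

lemma rank_one_update_mult_vec:
  "rank_one_update A t v *v w = A *v w + (t * (v \<bullet> w)) *\<^sub>R v"
  by (simp add: vec_eq_iff matrix_vector_mult_def inner_vec_def sum.distrib sum_distrib_left
      sum_distrib_right algebra_simps)

lemma trace_mult_rank_one_update:
  "trace (S ** rank_one_update A t v) = trace (S ** A) + t * (v \<bullet> (S *v v))"
  by (simp add: trace_def matrix_matrix_mult_def matrix_vector_mult_def inner_vec_def
      sum.distrib sum_distrib_left algebra_simps)

text \<open>In an orthonormal basis containing \<open>v\<close> the matrix is diagonal, with one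
  entry 1 + t and all others 1.\<close>

lemma det_rank_one_update_id:
  fixes v :: "real^'n::finite"
  assumes "norm v = 1"
  shows "det (rank_one_update (mat 1) t v) = 1 + t"
proof -
  obtain k :: 'n and A where A: "orthogonal_matrix A" "A *v axis k 1 = v"
    using orthogonal_matrix_exists_basis[OF assms] by metis
  let ?D = "rank_one_update (mat 1) t (axis k 1) :: real^'n^'n"
  have "rank_one_update (mat 1) t v = A ** ?D ** transpose A"
    using A by (simp add: matrix_mult_rank_one_update orthogonal_matrix_def)
  \<comment> \<open>Conjugation by \<open>A\<close> multiplies the determinant by this
    factor.\<close>
  moreover have "det A * det A = 1"
    using A(1) by (metis det_I det_mul det_transpose orthogonal_matrix_def)
  ultimately have "det (rank_one_update (mat 1) t v) = det ?D"
    by (simp add: det_mul)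
  also have "\<dots> = (\<Prod>i\<in>UNIV. ?D $ i $ i)"
    by (rule det_diagonal) (auto simp: mat_def axis_def)
  also have "\<dots> = (\<Prod>i\<in>UNIV. if i = k then 1 + t else 1)"
    by (rule prod.cong) (auto simp: mat_def axis_def)
  also have "\<dots> = 1 + t"
    by simp
  finally show ?thesis .
qed

lemma pos_def_rank_one_update_id:
  assumes "t \<ge> 0"
  shows "pos_def (rank_one_update (mat 1) t v)"
proof -
  have "w \<bullet> (rank_one_update (mat 1) t v *v w) = w \<bullet> w + t * (v \<bullet> w)\<^sup>2" for w
    by (simp add: rank_one_update_mult_vec inner_right_distrib power2_eq_square inner_commute)
  moreover have "0 < w \<bullet> w + t * (v \<bullet> w)\<^sup>2" if "w \<noteq> 0" for w
    using that assms by (simp add: add_pos_nonneg)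
  moreover have "sym_matrix (rank_one_update (mat 1) t v)"
    by (auto simp: sym_matrix_def vec_eq_iff transpose_def mat_def)
  ultimately show ?thesis
    by (simp add: pos_def_def)
qed

text \<open>The square of the index set splits into the pairs above, below and on the diagonal;
  swapping coordinates matches the first two classes.\<close>

lemma card_pairs_less:
  "real (card {(i, j). i < (j :: 'p::{finite,linorder})}) =
     real CARD('p) * (real CARD('p) - 1) / 2"
proof -
  let ?L = "{(i, j). i < (j :: 'p)}"
  have swap: "card {(i, j). j < (i :: 'p)} = card ?L"
    by (rule bij_betw_same_card[where f = prod.swap])
      (auto intro!: bij_betwI[where g = prod.swap])
  have "CARD('p) * CARD('p) = CARD('p \<times> 'p)"
    by simp
  also have "(UNIV :: ('p \<times> 'p) set) = ?L \<union> ({(i, j). j < i} \<union> Id)"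
    by auto
  also have "card \<dots> = card ?L + (card {(i, j). j < (i :: 'p)} + card (Id :: ('p \<times> 'p) set))"
    \<comment> \<open>The repetition splits both nested disjoint unions.\<close>
    by (subst card_Un_disjoint, simp, simp, force)+ simp
  also have "(Id :: ('p \<times> 'p) set) = range (\<lambda>i. (i, i))"
    by auto
  also have "card (range (\<lambda>i :: 'p. (i, i))) = CARD('p)"
    by (simp add: card_image inj_on_def)
  finally have "real CARD('p) * real CARD('p) = real (card ?L + (card ?L + CARD('p)))"
    unfolding swap by (metis of_nat_mult)
  then show ?thesis
    by (simp add: algebra_simps)
qed

text \<open>Diagonal entries are at least 1, where \<open>penD\<close> vanishes. An off-diagonal
  entry is t times a product of two coordinates of a unit vector, so monotonicity of
  \<open>pen\<close> in the absolute value bounds its penalty by \<open>pen t\<close>.\<close>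

lemma Pen_rank_one_update_id_le:
  fixes v :: "real^('p::{finite,linorder})"
  assumes pen: "offdiag_penalty pen" and penD: "\<forall>x>0. penD x = 0"
    and v: "norm v = 1" and t: "t \<ge> 0"
  shows "Pen penD pen (rank_one_update (mat 1) t v) \<le>
    real CARD('p) * (real CARD('p) - 1) / 2 * pen t"
proof -
  let ?\<Theta> = "rank_one_update (mat 1) t v"
  have comp: "\<bar>v $ i\<bar> \<le> 1" for i
    using component_le_norm_cart[of v i] v by simp
  have "penD (?\<Theta> $ i $ i) = 0" for i
    using penD t by (simp add: mat_def add_pos_nonneg mult.assoc)
  moreover have "pen (?\<Theta> $ i $ j) \<le> pen t" if "i < j" for i j
  proof -
    have "\<bar>v $ i\<bar> * \<bar>v $ j\<bar> \<le> 1"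
      using comp by (simp add: mult_le_one)
    then have "\<bar>?\<Theta> $ i $ j\<bar> \<le> \<bar>t\<bar>"
      using less_imp_neq[OF that] t by (simp add: mat_def abs_mult mult.assoc mult_left_le)
    then show ?thesis
      using pen by (simp add: offdiag_penalty_def)
  qed
  ultimately have "Pen penD pen ?\<Theta> \<le> (\<Sum>_\<in>{(i, j). i < (j :: 'p)}. pen t)"
    unfolding Pen_def
    by (simp del: rank_one_update_nth sum_constant) (rule sum_mono, auto simp del: rank_one_update_nth)
  also have "\<dots> = real CARD('p) * (real CARD('p) - 1) / 2 * pen t"
    by (simp add: card_pairs_less)
  finally show ?thesis .
qed

text \<open>If \<open>f\<close> were eventually at least \<open>c\<close>, so would be its lower
  limit. The conclusion is only "frequently", which suffices because one good point is needed for
  each bound.\<close>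

lemma Liminf_eq_minus_infinity_imp_frequently:
  fixes f :: "'a \<Rightarrow> real"
  assumes "Liminf F (\<lambda>x. ereal (f x)) = -\<infinity>"
  shows "\<exists>\<^sub>F x in F. f x < c"
proof (rule ccontr)
  assume "\<not> ?thesis"
  then have "\<forall>\<^sub>F x in F. ereal c \<le> ereal (f x)"
    by (simp add: not_frequently not_less)
  then have "ereal c \<le> Liminf F (\<lambda>x. ereal (f x))"
    by (rule Liminf_bounded)
  with assms show False
    by simp
qed

theorem proposition7:
  fixes pen penD :: "real \<Rightarrow> real"
    and S :: "real^('p::{finite,linorder})^('p::{finite,linorder})"
    and q :: real
  assumes "q = real CARD('p) * (real CARD('p) - 1) / 2"
    and "offdiag_penalty pen"
    and "\<forall>x>0. penD x = 0"
    and "Liminf at_infinity (\<lambda>x::real. ereal (q * pen x - ln \<bar>x\<bar>)) = -\<infinity>"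
    and "pos_semidef S"
    and "\<not> pos_def S"
  shows "\<not> pen_estimate_exists penD pen S"
proof
  assume "pen_estimate_exists penD pen S"
  then obtain B where B: "\<And>\<Theta>. pos_def \<Theta> \<Longrightarrow> pen_loglik penD pen S \<Theta> \<le> B"
    by (auto simp: pen_estimate_exists_def bdd_above_def)
  \<comment> \<open>As \<open>S\<close> is symmetric, definiteness can fail only at a nonzero vector
    whose quadratic form is not positive, hence zero by semidefiniteness.\<close>
  obtain w where w: "w \<noteq> 0" "w \<bullet> (S *v w) = 0"
    using assms(5,6) unfolding pos_def_def pos_semidef_def by (metis order_le_less)
  define v where "v = w /\<^sub>R norm w"
  have v: "norm v = 1" "v \<bullet> (S *v v) = 0"
    using w by (simp_all add: v_def scaleR_matrix_vector_assoc[symmetric] matrix_vector_mult_scaleR)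
  \<comment> \<open>The threshold is \<open>ln \<bar>x\<bar> - trace S - q * pen x > B\<close>
    rearranged.\<close>
  have "\<exists>\<^sub>F x in at_infinity. q * pen x - ln \<bar>x\<bar> < - B - trace S"
    using assms(4) by (rule Liminf_eq_minus_infinity_imp_frequently)
  \<comment> \<open>Keeps \<open>x\<close> away from 0, so that \<open>ln\<close> is monotone
    between \<open>\<bar>x\<bar>\<close> and \<open>1 + \<bar>x\<bar>\<close>.\<close>
  moreover have "\<forall>\<^sub>F x::real in at_infinity. 1 \<le> norm x"
    unfolding eventually_at_infinity by blast
  ultimately obtain x where x: "q * pen x - ln \<bar>x\<bar> < - B - trace S" "1 \<le> \<bar>x\<bar>"
    using frequently_ex[OF frequently_eventually_frequently] by fastforce
  \<comment> \<open>The point \<open>x\<close> may be negative, while the update needs a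
    non-negative coefficient; symmetry of \<open>pen\<close> makes up for the absolute
    value.\<close>
  let ?\<Theta> = "rank_one_update (mat 1) \<bar>x\<bar> v"
  have "ln \<bar>x\<bar> \<le> ln (1 + \<bar>x\<bar>)"
    using x(2) by simp
  moreover have "pen \<bar>x\<bar> = pen x"
    using assms(2) by (auto simp: offdiag_penalty_def abs_if)
  then have "Pen penD pen ?\<Theta> \<le> q * pen x"
    unfolding assms(1)
    using Pen_rank_one_update_id_le[OF assms(2,3) v(1), of "\<bar>x\<bar>"] by (simp only: abs_ge_zero)
  ultimately have "B < pen_loglik penD pen S ?\<Theta>"
    using x(1) v by (simp add: pen_loglik_def det_rank_one_update_id trace_mult_rank_one_update)
  with B[OF pos_def_rank_one_update_id[of "\<bar>x\<bar>" v]] show False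
    by simp
qed

end
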